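(* Let $\lambda\in\mathbb{R}$ and $x$ an indeterminate. For all integers $n,k\ge0$ with $n-k\equiv0\pmod 2$, \[ \sum_{m=0}^{n}\Big(\frac{x^n}{k!}\sum_{l=0}^{k}\binom{k}{l}(-1)^{k-l}\big(l-\tfrac{k}{2}\big)^m\Big)\lambda^{n-m}S_1(n,m) =\begin{cases} T_{n,k}(x,x^2,\dots,x^{n-k+1}\mid\lambda), & n\ge k,\\ 0, & n<k.\end{cases} \] In particular, \[ \sum_{m=0}^{n}\Big(\frac{1}{k!}\sum_{l=0}^{k}\binom{k}{l}(-1)^{k-l}\big(l-\tfrac{k}{2}\big)^m\Big)\lambda^{n-m}S_1(n,m) =\begin{cases} T_{n,k}(1,1,\dots,1\mid\lambda), & n\ge k,\\ 0, & n<k.\end{cases} \]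
   Context: $S_1(n,m)$ are the (signed) Stirling numbers of the first kind, defined by $\frac{1}{m!}(\log(1+t))^m=\sum_{n\ge m}S_1(n,m)\frac{t^n}{n!}$ (and $S_1(n,m)=0$ for $m>n$); the convention $0^0=1$ is used. For $\lambda\in\mathbb{R}$, $(x)_{0,\lambda}=1$, $(x)_{n,\lambda}=x(x-\lambda)\cdots(x-(n-1)\lambda)$ and $\langle x\rangle_{0,\lambda}=1$, $\langle x\rangle_{n,\lambda}=x(x+\lambda)\cdots(x+(n-1)\lambda)$ for $n\ge1$. The degenerate central incomplete Bell polynomials $T_{n,k}(x_1,\dots,x_{n-k+1}\mid\lambda)$ are defined for integers $k\ge0$ by \[ \frac{1}{k!}\Big(\sum_{m=1}^\infty x_m\big((\tfrac12)_{m,\lambda}-(-1)^m\langle\tfrac12\rangle_{m,\lambda}\big)\frac{t^m}{m!}\Big)^k=\sum_{n=k}^\infty T_{n,k}(x_1,\dots,x_{n-k+1}\mid\lambda)\frac{t^n}{n!}. \] *)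

theory Defs
  imports
    Complex_Main
    "HOL-Computational_Algebra.Polynomial"
    "HOL-Computational_Algebra.Formal_Power_Series"
begin

(* Scalar multiplication by reals on univariate polynomials. It makes "real poly" a commutative
   real algebra, so that one definition of the Bell polynomials can be evaluated both at
   real numbers and at powers of an indeterminate. *)

instantiation poly :: (real_vector) real_vector
begin

definition scaleR_poly :: "real \<Rightarrow> 'a poly \<Rightarrow> 'a poly" where
  "scaleR_poly r p = map_poly (scaleR r) p"

lemma coeff_scaleR_poly: "coeff (r *\<^sub>R p) i = r *\<^sub>R coeff p i" for p :: "'a poly"
  by (simp add: scaleR_poly_def coeff_map_poly)

instance
  by standard (simp_all add: poly_eq_iff coeff_scaleR_poly scaleR_add_left scaleR_add_right)

end

instance poly :: ("{real_algebra, comm_ring}") real_algebra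
  by standard (simp_all add: poly_eq_iff coeff_scaleR_poly coeff_mult scaleR_sum_right)

instance poly :: ("{real_algebra_1, comm_ring_1}") real_algebra_1 ..

lemma scaleR_real_poly: "r *\<^sub>R p = smult r p" for p :: "real poly"
  by (simp add: poly_eq_iff coeff_scaleR_poly)

(* fps_ln 1 is the series of log (1 + t). *)
definition S1 :: "nat \<Rightarrow> nat \<Rightarrow> real" where
  "S1 n m = fact n * fps_nth (fps_const (1 / fact m) * fps_ln 1 ^ m) n"

definition degenerate_falling :: "real \<Rightarrow> real \<Rightarrow> nat \<Rightarrow> real" where
  "degenerate_falling lam x n = (\<Prod>i<n. x - real i * lam)"

definition degenerate_rising :: "real \<Rightarrow> real \<Rightarrow> nat \<Rightarrow> real" where
  "degenerate_rising lam x n = (\<Prod>i<n. x + real i * lam)"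

(* The arguments x_1, x_2, ... are given as a sequence xs in a commutative real algebra; xs 0 is
   never used. *)
definition central_series :: "real \<Rightarrow> (nat \<Rightarrow> 'a::{comm_ring_1, real_algebra_1}) \<Rightarrow> 'a fps" where
  "central_series lam xs = Abs_fps (\<lambda>m. if m = 0 then 0 else
     ((degenerate_falling lam (1/2) m - (-1) ^ m * degenerate_rising lam (1/2) m) / fact m) *\<^sub>R xs m)"

(* n! times the coefficient of t^n in (1/k!) (central_series)^k. The two lemmas below show that this
   coefficient vanishes for n < k, and that for n >= k it involves only x_1, ..., x_(n-k+1). *)
definition central_bell :: "nat \<Rightarrow> nat \<Rightarrow> (nat \<Rightarrow> 'a::{comm_ring_1, real_algebra_1}) \<Rightarrow> real \<Rightarrow> 'a" where
  "central_bell n k xs lam = fact n *\<^sub>R ((1 / fact k) *\<^sub>R fps_nth (central_series lam xs ^ k) n)"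

lemma central_bell_eq_0: "n < k \<Longrightarrow> central_bell n k xs lam = 0"
  using startsby_zero_power_prefix[of "central_series lam xs" k]
  by (simp add: central_bell_def central_series_def)

lemma fps_power_nth_cong:
  fixes f g :: "'a::comm_ring_1 fps"
  assumes "\<And>i. i \<le> d \<Longrightarrow> fps_nth f i = fps_nth g i" and "i \<le> d"
  shows "fps_nth (f ^ k) i = fps_nth (g ^ k) i"
  using assms(2)
proof (induction k arbitrary: i)
  case (Suc k)
  then show ?case
    by (auto simp: fps_mult_nth assms(1) intro!: sum.cong)
qed simp

lemma central_bell_cong:
  assumes "k \<le> n" and "\<And>i. 1 \<le> i \<Longrightarrow> i \<le> n - k + 1 \<Longrightarrow> xs i = ys i"
  shows "central_bell n k xs lam = central_bell n k ys lam"
proof -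
  have shift: "fps_nth (central_series lam zs ^ k) n
      = fps_nth (fps_shift 1 (central_series lam zs) ^ k) (n - k)" for zs :: "nat \<Rightarrow> 'a"
  proof -
    have "central_series lam zs = fps_X * fps_shift 1 (central_series lam zs)"
      by (simp add: fps_eq_iff central_series_def)
    then have "central_series lam zs ^ k = fps_X ^ k * fps_shift 1 (central_series lam zs) ^ k"
      by (metis power_mult_distrib)
    then show ?thesis
      using assms(1) by (simp add: fps_X_power_mult_nth)
  qed
  have "fps_nth (fps_shift 1 (central_series lam xs) ^ k) (n - k)
      = fps_nth (fps_shift 1 (central_series lam ys) ^ k) (n - k)"
    by (rule fps_power_nth_cong[where d = "n - k"]) (simp_all add: central_series_def assms(2))
  then show ?thesis
    by (simp add: central_bell_def shift)
qed

end

theory Submission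
  imports Defs
begin

text \<open>
  Since \<open>(-1)\<^sup>m\<langle>y\<rangle>\<^sub>m = (-y)\<^sub>m\<close>, the central series with all arguments \<open>1\<close> is \<open>e(1/2) - e(-1/2)\<close>,
  where \<open>e(y)\<close> is the degenerate exponential, the unique solution of \<open>(1 + \<lambda>t) f' = y f\<close> with
  \<open>f(0) = 1\<close>. The differential equation gives \<open>e(y + z) = e(y) e(z)\<close>, so the binomial theorem
  expands the \<open>k\<close>-th power into the \<open>e(l - k/2)\<close>, and the Stirling numbers of the first kind express the
  degenerate falling factorials of \<open>l - k/2\<close> through ordinary powers. Replacing the arguments by
  \<open>x\<^sup>m\<close> rescales \<open>t\<close> to \<open>xt\<close>.
\<close>

text \<open>The series of \<open>(1 + lam * t)\<close> to the power \<open>y / lam\<close>, or of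
  \<open>exp (y * t)\<close> when \<open>lam = 0\<close>. Giving the coefficients directly avoids
  dividing by \<open>lam\<close>.\<close>

definition degenerate_exp :: "real \<Rightarrow> real \<Rightarrow> real fps" where
  "degenerate_exp lam y = Abs_fps (\<lambda>n. degenerate_falling lam y n / fact n)"

lemma degenerate_falling_0 [simp]: "degenerate_falling lam y 0 = 1"
  by (simp add: degenerate_falling_def)

lemma degenerate_falling_Suc:
  "degenerate_falling lam y (Suc n) = degenerate_falling lam y n * (y - real n * lam)"
  by (simp add: degenerate_falling_def)

lemma degenerate_falling_uminus:
  "degenerate_falling lam (- y) n = (-1) ^ n * degenerate_rising lam y n"
proof -
  have "degenerate_falling lam (- y) n = (\<Prod>i<n. (-1) * (y + real i * lam))"
    by (simp add: degenerate_falling_def)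
  also have "\<dots> = (-1) ^ n * degenerate_rising lam y n"
    unfolding prod.distrib by (simp add: degenerate_rising_def)
  finally show ?thesis .
qed

lemma degenerate_exp_nth_0 [simp]: "fps_nth (degenerate_exp lam y) 0 = 1"
  by (simp add: degenerate_exp_def)

text \<open>Turns a differential equation into a recurrence for coefficients; it serves
  \<open>degenerate_exp\<close> with \<open>c = lam\<close> and the powers of the logarithm with
  \<open>c = 1\<close>.\<close>

lemma fps_nth_one_plus_const_X_times_deriv:
  fixes f :: "'a::comm_ring_1 fps"
  shows "fps_nth ((1 + fps_const c * fps_X) * fps_deriv f) n
    = of_nat (Suc n) * fps_nth f (Suc n) + c * of_nat n * fps_nth f n"
  by (cases n) (simp_all add: distrib_right mult.assoc)

lemma degenerate_exp_ode:
  "(1 + fps_const lam * fps_X) * fps_deriv (degenerate_exp lam y) = fps_const y * degenerate_exp lam y"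
proof (rule fps_ext)
  fix n
  show "fps_nth ((1 + fps_const lam * fps_X) * fps_deriv (degenerate_exp lam y)) n
      = fps_nth (fps_const y * degenerate_exp lam y) n"
    unfolding fps_nth_one_plus_const_X_times_deriv
    by (simp add: degenerate_exp_def degenerate_falling_Suc field_simps del: of_nat_Suc)
qed

lemma degenerate_exp_unique:
  assumes ode: "(1 + fps_const lam * fps_X) * fps_deriv f = fps_const y * f"
    and init: "fps_nth f 0 = 1"
  shows "f = degenerate_exp lam y"
proof (rule fps_ext)
  fix n
  show "fps_nth f n = fps_nth (degenerate_exp lam y) n"
  proof (induction n)
    case 0
    then show ?case
      using init by simp
  next
    case (Suc n)
    \<comment> \<open>Stated for every solution \<open>g\<close>, so that it applies to both
      \<open>f\<close> and \<open>degenerate_exp lam y\<close>.\<close>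
    have "real (Suc n) * fps_nth g (Suc n) = (y - lam * real n) * fps_nth g n"
      if "(1 + fps_const lam * fps_X) * fps_deriv g = fps_const y * g" for g :: "real fps"
      using arg_cong[OF that, of "\<lambda>h. fps_nth h n"]
      unfolding fps_nth_one_plus_const_X_times_deriv by (simp add: algebra_simps)
    from this[OF ode] this[OF degenerate_exp_ode]
    have "real (Suc n) * fps_nth f (Suc n) = real (Suc n) * fps_nth (degenerate_exp lam y) (Suc n)"
      using Suc.IH by simp
    then show ?case
      by (simp del: of_nat_Suc)
  qed
qed

lemma degenerate_exp_0: "degenerate_exp lam 0 = 1"
  by (rule degenerate_exp_unique[symmetric]) simp_all

text \<open>By the Leibniz rule the product solves the equation with parameter \<open>y + z\<close>,
  so uniqueness applies.\<close>

lemma degenerate_exp_add: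
  "degenerate_exp lam (y + z) = degenerate_exp lam y * degenerate_exp lam z"
proof (rule degenerate_exp_unique[symmetric])
  let ?e = "degenerate_exp lam"
  let ?u = "1 + fps_const lam * fps_X"
  have "?u * fps_deriv (?e y * ?e z) = ?e y * (?u * fps_deriv (?e z)) + (?u * fps_deriv (?e y)) * ?e z"
    by (simp add: algebra_simps)
  also have "\<dots> = fps_const (y + z) * (?e y * ?e z)"
    unfolding degenerate_exp_ode by (simp add: algebra_simps flip: fps_const_add)
  finally show "?u * fps_deriv (?e y * ?e z) = fps_const (y + z) * (?e y * ?e z)" .
qed simp

lemma degenerate_exp_power: "degenerate_exp lam y ^ k = degenerate_exp lam (real k * y)"
  by (induction k) (simp_all add: degenerate_exp_0 distrib_right flip: degenerate_exp_add)

lemma S1_0_left: "S1 0 m = (if m = 0 then 1 else 0)"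
  by (simp add: S1_def fps_power_zeroth)

lemma S1_eq_0: "n < m \<Longrightarrow> S1 n m = 0"
  using startsby_zero_power_prefix[of "fps_ln 1 :: real fps" m] by (simp add: S1_def)

lemma S1_Suc_0: "S1 (Suc n) 0 = 0"
  by (simp add: S1_def)

text \<open>Reads off coefficients in \<open>(1 + t) (L\<^sup>m\<^sup>+\<^sup>1/(m+1)!)' = L\<^sup>m/m!\<close> for \<open>L = log (1 + t)\<close>.\<close>

lemma S1_Suc_Suc: "S1 (Suc n) (Suc m) = S1 n m - real n * S1 n (Suc m)"
proof -
  define L :: "real fps" where "L = fps_ln 1"
  define g where "g = (\<lambda>m. fps_const (1 / fact m) * L ^ m)"
  have S1: "S1 n m = fact n * fps_nth (g m) n" for n m
    by (simp add: S1_def g_def L_def)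
  have "(1 + fps_X) * fps_deriv L = 1"
    unfolding L_def fps_ln_deriv by (simp add: inverse_mult_eq_1')
  moreover have "fps_deriv (g (Suc m)) = fps_deriv L * g m"
  proof -
    have "fps_deriv (g (Suc m)) = fps_const (real (Suc m) / fact (Suc m)) * fps_deriv L * L ^ m"
      unfolding g_def fps_deriv_mult_const_left fps_deriv_power
      by (simp add: fps_eq_iff mult.assoc del: fact_Suc of_nat_Suc power_Suc)
    also have "real (Suc m) / fact (Suc m) = 1 / fact m"
      by (simp del: of_nat_Suc)
    finally show ?thesis
      by (simp add: g_def mult_ac)
  qed
  ultimately have "(1 + fps_const 1 * fps_X) * fps_deriv (g (Suc m)) = g m"
    by (simp flip: mult.assoc)
  from arg_cong[OF this, of "\<lambda>h. fps_nth h n"]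
  have "real (Suc n) * fps_nth (g (Suc m)) (Suc n) + real n * fps_nth (g (Suc m)) n = fps_nth (g m) n"
    unfolding fps_nth_one_plus_const_X_times_deriv by simp
  then have "fact n * fps_nth (g m) n
      = fact n * (real (Suc n) * fps_nth (g (Suc m)) (Suc n) + real n * fps_nth (g (Suc m)) n)"
    by simp
  then show ?thesis
    unfolding S1 by (simp add: algebra_simps)
qed

text \<open>The two terms of \<open>S1_Suc_Suc\<close> match the two terms of the new factor
  \<open>y - real n * lam\<close>.\<close>

lemma degenerate_falling_eq_sum_S1:
  "degenerate_falling lam y n = (\<Sum>m\<le>n. lam ^ (n - m) * S1 n m * y ^ m)"
proof (induction n)
  case 0
  then show ?case
    by (simp add: S1_0_left)
next
  case (Suc n)
  define a where "a = (\<lambda>m. lam ^ (n - m) * S1 n m * y ^ m)"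
  have "(\<Sum>m\<le>Suc n. lam ^ (Suc n - m) * S1 (Suc n) m * y ^ m)
      = (\<Sum>m\<le>n. lam ^ (n - m) * (S1 n m - real n * S1 n (Suc m)) * y ^ Suc m)"
    by (simp add: sum.atMost_Suc_shift S1_Suc_0 S1_Suc_Suc del: sum.atMost_Suc power_Suc)
  also have "\<dots> = y * (\<Sum>m\<le>n. a m)
      - real n * (\<Sum>m\<le>n. lam ^ (Suc n - Suc m) * S1 n (Suc m) * y ^ Suc m)"
    by (simp add: a_def algebra_simps sum_subtractf sum_distrib_left)
  \<comment> \<open>The sum regains its term at \<open>m = 0\<close>: it vanishes for positive
    \<open>n\<close>, and for \<open>n = 0\<close> the factor \<open>real n\<close> kills both
    sides.\<close>
  also have "real n * (\<Sum>m\<le>n. lam ^ (Suc n - Suc m) * S1 n (Suc m) * y ^ Suc m)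
      = real n * (\<Sum>m\<le>Suc n. lam ^ (Suc n - m) * S1 n m * y ^ m)"
    by (cases n) (simp_all add: sum.atMost_Suc_shift S1_Suc_0 del: sum.atMost_Suc power_Suc)
  \<comment> \<open>The top term vanishes by \<open>S1_eq_0\<close>; every other term has a spare
    factor \<open>lam\<close>.\<close>
  also have "(\<Sum>m\<le>Suc n. lam ^ (Suc n - m) * S1 n m * y ^ m) = lam * (\<Sum>m\<le>n. a m)"
    by (simp add: S1_eq_0 a_def sum_distrib_left Suc_diff_le mult.assoc)
  finally show ?case
    by (simp add: degenerate_falling_Suc Suc.IH a_def algebra_simps)
qed

lemma central_series_1:
  "central_series lam (\<lambda>_. 1) = degenerate_exp lam (1/2) - degenerate_exp lam (-1/2)"
  using degenerate_falling_uminus[of lam "1/2"]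
  by (simp add: fps_eq_iff central_series_def degenerate_exp_def diff_divide_distrib
      degenerate_rising_def)

lemma central_series_1_power:
  "central_series lam (\<lambda>_. 1) ^ k
    = (\<Sum>l\<le>k. fps_const (real (k choose l) * (-1) ^ (k - l)) * degenerate_exp lam (real l - real k / 2))"
proof -
  let ?e = "degenerate_exp lam"
  have "central_series lam (\<lambda>_. 1) ^ k = (?e (1/2) + (- ?e (-1/2))) ^ k"
    by (simp add: central_series_1)
  also have "\<dots> = (\<Sum>l\<le>k. of_nat (k choose l) * ?e (1/2) ^ l * (- ?e (-1/2)) ^ (k - l))"
    by (rule binomial_ring)
  also have "\<dots> = (\<Sum>l\<le>k. fps_const (real (k choose l) * (-1) ^ (k - l)) * ?e (real l - real k / 2))"
  proof (rule sum.cong[OF refl])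
    fix l assume "l \<in> {..k}"
    \<comment> \<open>The bound \<open>l \<le> k\<close> turns the truncated \<open>k - l\<close>
      into a real difference.\<close>
    then have arg: "real l * (1/2) + real (k - l) * (-1/2) = real l - real k / 2"
      by (simp add: of_nat_diff field_simps)
    have "?e (1/2) ^ l * ?e (-1/2) ^ (k - l) = ?e (real l - real k / 2)"
      unfolding degenerate_exp_power degenerate_exp_add[symmetric] arg ..
    moreover have "(- ?e (-1/2)) ^ (k - l) = fps_const ((-1) ^ (k - l)) * ?e (-1/2) ^ (k - l)"
      by (subst power_minus) (simp flip: fps_const_power fps_const_neg)
    ultimately show "of_nat (k choose l) * ?e (1/2) ^ l * (- ?e (-1/2)) ^ (k - l)
        = fps_const (real (k choose l) * (-1) ^ (k - l)) * ?e (real l - real k / 2)"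
      by (simp add: fps_of_nat mult_ac flip: fps_const_mult)
  qed
  finally show ?thesis .
qed

lemma central_bell_1:
  "central_bell n k (\<lambda>_. 1 :: real) lam
    = 1 / fact k * (\<Sum>l\<le>k. real (k choose l) * (-1) ^ (k - l) * degenerate_falling lam (real l - real k / 2) n)"
  by (simp add: central_bell_def central_series_1_power fps_sum_nth degenerate_exp_def
      sum_distrib_left field_simps)

lemma central_bell_1_eq_sum_S1:
  "central_bell n k (\<lambda>_. 1 :: real) lam
    = (\<Sum>m\<le>n. (1 / fact k * (\<Sum>l\<le>k. real (k choose l) * (-1) ^ (k - l) * (real l - real k / 2) ^ m))
        * lam ^ (n - m) * S1 n m)"
  unfolding central_bell_1 degenerate_falling_eq_sum_S1 sum_distrib_left sum_distrib_right
  by (subst sum.swap) (simp add: mult_ac)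

text \<open>In each Cauchy product the powers \<open>x ^ i\<close> and \<open>x ^ (n - i)\<close>
  combine to \<open>x ^ n\<close>, leaving a real coefficient as scalar.\<close>

lemma central_series_powers_power_nth:
  fixes x :: "'a::{comm_ring_1, real_algebra_1}"
  shows "fps_nth (central_series lam (\<lambda>i. x ^ i) ^ k) n
    = fps_nth (central_series lam (\<lambda>_. 1 :: real) ^ k) n *\<^sub>R x ^ n"
proof (induction k arbitrary: n)
  case 0
  then show ?case
    by simp
next
  case (Suc k)
  have nth: "fps_nth (central_series lam (\<lambda>i. x ^ i)) i
      = fps_nth (central_series lam (\<lambda>_. 1 :: real)) i *\<^sub>R x ^ i" for i
    by (simp add: central_series_def)
  show ?case
    by (simp add: fps_mult_nth nth Suc.IH scaleR_sum_left mult.commute flip: power_add)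
qed

lemma central_bell_powers:
  fixes x :: "'a::{comm_ring_1, real_algebra_1}"
  shows "central_bell n k (\<lambda>i. x ^ i) lam = central_bell n k (\<lambda>_. 1 :: real) lam *\<^sub>R x ^ n"
  by (simp add: central_bell_def central_series_powers_power_nth)

theorem theorem2p2:
  fixes lam :: real and n k :: nat and x :: "real poly"
  assumes x: "x = [:0, 1:]"
    and parity: "(int n - int k) mod 2 = 0"
  shows "((\<Sum>m=0..n. smult (lam ^ (n - m) * S1 n m)
            (smult (1 / fact k * (\<Sum>l=0..k. real (k choose l) * (-1) ^ (k - l) * (real l - real k / 2) ^ m))
              (x ^ n)))
         = (if k \<le> n then central_bell n k (\<lambda>i. x ^ i) lam else 0))
    \<and> ((\<Sum>m=0..n.
            (1 / fact k * (\<Sum>l=0..k. real (k choose l) * (-1) ^ (k - l) * (real l - real k / 2) ^ m))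
              * lam ^ (n - m) * S1 n m)
         = (if k \<le> n then central_bell n k (\<lambda>i. 1 :: real) lam else 0))"
proof -
  define c where "c = (\<lambda>m. 1 / fact k
    * (\<Sum>l=0..k. real (k choose l) * (-1) ^ (k - l) * (real l - real k / 2) ^ m))"
  have real_case: "(\<Sum>m=0..n. c m * lam ^ (n - m) * S1 n m) = central_bell n k (\<lambda>i. 1 :: real) lam"
    by (simp add: c_def central_bell_1_eq_sum_S1 atLeast0AtMost)
  \<comment> \<open>All summands are real multiples of the same \<open>x ^ n\<close>, so the
    polynomial identity reduces to the real one.\<close>
  have "(\<Sum>m=0..n. smult (lam ^ (n - m) * S1 n m) (smult (c m) (x ^ n)))
      = smult (\<Sum>m=0..n. c m * lam ^ (n - m) * S1 n m) (x ^ n)"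
    by (simp add: smult_sum mult_ac)
  also have "\<dots> = central_bell n k (\<lambda>i. x ^ i) lam"
    unfolding real_case central_bell_powers scaleR_real_poly ..
  \<comment> \<open>The case \<open>n < k\<close> is covered because \<open>central_bell\<close>
    itself vanishes there.\<close>
  finally show ?thesis
    using real_case unfolding c_def by (simp add: central_bell_eq_0)
qed

end
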